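(* Let $G$ be a nontrivial uniquely $C_4^{+}$-saturated graph with girth $3$, and let $S$ be the vertex set of a triangle in $G$. If $N^{2}(S)=\emptyset$, then $G$ is isomorphic to $C_3^{*}$.
   Context: All graphs are finite, simple and undirected. $C_4^{+}$ (the diamond) is the graph obtained from a $4$-cycle by adding one chord, i.e. $K_4$ minus an edge. $C_3^{*}$ is the graph consisting of a triangle with one pendant edge attached (4 vertices, 4 edges). For a graph $H$, a graph $G$ is uniquely $H$-saturated if $G$ contains no subgraph isomorphic to $H$, but for every pair of non-adjacent vertices $u,v$ of $G$, the graph $G+uv$ contains exactly one subgraph isomorphic to $H$. A uniquely $H$-saturated graph is nontrivial if it has at least $|V(H)|$ vertices. The girth is the minimum length of a cycle. For $U\subseteq V(G)$, $d(v,U)=\min\{d(v,u):u\in U\}$ and $N^{2}(U)=\{v\in V(G): d(v,U)=2\}$. *)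

theory Defs
  imports "Graph_Theory.Graph_Theory" "HOL-Library.Extended_Nat"
begin

text \<open>
  Finite simple undirected graphs are represented by \<^locale>\<open>pair_graph\<close>, i.e. finite loop-free
  symmetric digraphs without parallel arcs: an edge \<open>uv\<close> is the pair of arcs \<open>(u,v)\<close>, \<open>(v,u)\<close>.
\<close>

definition add_edge :: "'a \<Rightarrow> 'a \<Rightarrow> 'a pair_pre_digraph \<Rightarrow> 'a pair_pre_digraph" where
  "add_edge u v G = G\<lparr>parcs := parcs G \<union> {(u, v), (v, u)}\<rparr>"

text \<open>
  The condition \<^term>\<open>pair_graph F\<close> restricts \<^const>\<open>subgraph\<close>, which is a notion for digraphs,
  to subgraphs in the undirected sense. Copies are subgraphs (vertex set and edge set),
  not embeddings, so the automorphisms of \<open>H\<close> are not counted.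
\<close>

definition copies :: "'b pair_pre_digraph \<Rightarrow> 'a pair_pre_digraph \<Rightarrow> 'a pair_pre_digraph set" where
  "copies H G = {F. pair_graph F \<and> subgraph (with_proj F) (with_proj G)
                    \<and> digraph_iso (with_proj F) (with_proj H)}"

definition uniquely_saturated :: "'b pair_pre_digraph \<Rightarrow> 'a pair_pre_digraph \<Rightarrow> bool" where
  "uniquely_saturated H G \<longleftrightarrow>
     copies H G = {} \<and>
     (\<forall>u\<in>pverts G. \<forall>v\<in>pverts G. u \<noteq> v \<and> (u, v) \<notin> parcs G \<longrightarrow>
        (\<exists>!F. F \<in> copies H (add_edge u v G)))"

definition nontrivial_uniquely_saturated ::
    "'b pair_pre_digraph \<Rightarrow> 'a pair_pre_digraph \<Rightarrow> bool" where
  "nontrivial_uniquely_saturated H G \<longleftrightarrow>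
     uniquely_saturated H G \<and> card (pverts H) \<le> card (pverts G)"

text \<open>The diamond: the 4-cycle 0, 1, 2, 3 with the chord 02.\<close>

definition C4_plus :: "nat pair_pre_digraph" where
  "C4_plus = add_edge 0 2 (mk_symmetric (with_proj
     \<lparr>pverts = {0, 1, 2, 3}, parcs = {(0, 1), (1, 2), (2, 3), (3, 0)}\<rparr>))"

text \<open>The triangle 0, 1, 2 with the pendant edge 03.\<close>

definition C3_star :: "nat pair_pre_digraph" where
  "C3_star = mk_symmetric (with_proj
     \<lparr>pverts = {0, 1, 2, 3}, parcs = {(0, 1), (1, 2), (2, 0), (0, 3)}\<rparr>)"

text \<open>
  In a symmetric digraph an edge traversed back and forth is a directed cycle of length 2,
  hence the length bound. The girth of an acyclic graph is infinite.
\<close>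

definition girth :: "'a pair_pre_digraph \<Rightarrow> enat" where
  "girth G = (INF p\<in>{p. pre_digraph.cycle (with_proj G) p \<and> 3 \<le> length p}. enat (length p))"

definition triangle_verts :: "'a pair_pre_digraph \<Rightarrow> 'a set \<Rightarrow> bool" where
  "triangle_verts G S \<longleftrightarrow>
     (\<exists>T. subgraph (with_proj T) (with_proj G) \<and> complete_digraph 3 (with_proj T) \<and> pverts T = S)"

text \<open>The distance of vertices in different components is infinite.\<close>

definition gdist :: "'a pair_pre_digraph \<Rightarrow> 'a \<Rightarrow> 'a \<Rightarrow> ereal" where
  "gdist G u v = wf_digraph.\<mu> (with_proj G) (\<lambda>_. 1) u v"

definition gdist_set :: "'a pair_pre_digraph \<Rightarrow> 'a \<Rightarrow> 'a set \<Rightarrow> ereal" where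
  "gdist_set G v U = (INF u\<in>U. gdist G v u)"

definition N2 :: "'a pair_pre_digraph \<Rightarrow> 'a set \<Rightarrow> 'a set" where
  "N2 G U = {v \<in> pverts G. gdist_set G v U = 2}"

lemma pverts_C4_plus: "pverts C4_plus = {0, 1, 2, 3}"
  by (simp add: C4_plus_def add_edge_def mk_symmetric_def)

lemma parcs_C4_plus:
  "parcs C4_plus = {(0,1),(1,0),(1,2),(2,1),(2,3),(3,2),(3,0),(0,3),(0,2),(2,0)}"
  by (auto simp: C4_plus_def add_edge_def mk_symmetric_def)

lemma pverts_C3_star: "pverts C3_star = {0, 1, 2, 3}"
  by (simp add: C3_star_def mk_symmetric_def)

lemma parcs_C3_star: "parcs C3_star = {(0,1),(1,0),(1,2),(2,1),(2,0),(0,2),(0,3),(3,0)}"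
  by (auto simp: C3_star_def mk_symmetric_def)

lemma pair_graph_C4_plus: "pair_graph C4_plus"
  by unfold_locales (auto simp: pverts_C4_plus parcs_C4_plus symmetric_def intro!: symI)

lemma pair_graph_C3_star: "pair_graph C3_star"
  by unfold_locales (auto simp: pverts_C3_star parcs_C3_star symmetric_def intro!: symI)

lemma pair_graph_add_edge:
  assumes "pair_graph G" "u \<in> pverts G" "v \<in> pverts G" "u \<noteq> v"
  shows "pair_graph (add_edge u v G)"
proof -
  interpret pair_graph G by fact
  have "sym (parcs G)" using pair_sym_arcs by (simp add: symmetric_def)
  then show ?thesis
    using assms(2-4)
    by unfold_locales
      (auto simp: add_edge_def symmetric_def intro!: symI
            dest: symD in_arcsD1 in_arcsD2 pair_no_loops)
qed

end

theory Submission
  imports Defs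
begin

text \<open>
  Let \<open>abc\<close> be the triangle. A non-edge \<open>uv\<close> is completed to a diamond, so \<open>u\<close> and \<open>v\<close> have a
  common neighbour, and one of them has a second neighbour. Hence a vertex outside \<open>S\<close> without
  neighbour in \<open>S\<close> would be at distance 2 from \<open>S\<close>, so every vertex outside \<open>S\<close> has a neighbour
  in \<open>S\<close>, and only one since \<open>G\<close> contains no diamond. If \<open>x \<notin> S\<close> is adjacent to \<open>a\<close>, then
  adding \<open>xb\<close> creates the diamond on \<open>x, a, b, c\<close>; a second neighbour \<open>y\<close> of \<open>x\<close> would yield
  another one, on \<open>x, y, a, b\<close>, when \<open>y\<close> is adjacent to \<open>a\<close> or \<open>b\<close>, and likewise with \<open>c\<close> in
  place of \<open>b\<close>. So all vertices outside \<open>S\<close> have degree 1, and two such vertices would form a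
  non-edge neither end of which has a second neighbour.
\<close>

section \<open>Isomorphisms and copies of the diamond, in terms of vertices and arcs\<close>

lemma digraph_iso_with_proj_iff:
  assumes "pair_wf_digraph G"
  shows "digraph_iso (with_proj G) (with_proj H) \<longleftrightarrow>
    (\<exists>f. inj_on f (pverts G) \<and> pverts H = f ` pverts G \<and> parcs H = map_prod f f ` parcs G)"
    (is "?L \<longleftrightarrow> ?R")
proof
  interpret pair_wf_digraph G by fact
  assume ?L
  then obtain h where h: "digraph_isomorphism h" "with_proj H = app_iso h (with_proj G)"
    by (auto simp: digraph_iso_def)
  have tail: "fst = iso_tail h" and head: "snd = iso_head h"
    and verts: "pverts H = iso_verts h ` pverts G" and arcs: "parcs H = iso_arcs h ` parcs G"
    using arg_cong[OF h(2), of tail] arg_cong[OF h(2), of head]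
      arg_cong[OF h(2), of verts] arg_cong[OF h(2), of arcs] by simp_all
  \<comment> \<open>Tail and head are \<open>fst\<close> and \<open>snd\<close> on both sides, so an
    arc map compatible with them is forced by the vertex map.\<close>
  have "iso_arcs h e = map_prod (iso_verts h) (iso_verts h) e" if "e \<in> parcs G" for e
    using h(1) that unfolding digraph_isomorphism_def tail[symmetric] head[symmetric]
    by (cases e) (auto simp: prod_eq_iff)
  then have "parcs H = map_prod (iso_verts h) (iso_verts h) ` parcs G"
    unfolding arcs by (rule image_cong[OF refl])
  moreover have "inj_on (iso_verts h) (pverts G)"
    using h(1) by (simp add: digraph_isomorphism_def)
  ultimately show ?R using verts by blast
next
  interpret pair_wf_digraph G by fact
  assume ?R
  then obtain f where f: "inj_on f (pverts G)" "pverts H = f ` pverts G"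
    "parcs H = map_prod f f ` parcs G" by blast
  define h where
    "h = \<lparr>iso_verts = f, iso_arcs = map_prod f f, iso_head = snd, iso_tail = fst\<rparr>"
  have "inj_on (map_prod f f) (parcs G)"
    by (intro inj_on_subset[OF map_prod_inj_on[OF f(1) f(1)]])
      (auto dest: in_arcsD1 in_arcsD2)
  then have "digraph_isomorphism h"
    using f(1) wf_digraph_axioms by (auto simp: digraph_isomorphism_def h_def)
  moreover have "with_proj H = app_iso h (with_proj G)"
    using f by (simp add: app_iso_def h_def with_proj_def)
  ultimately show ?L unfolding digraph_iso_def by blast
qed

lemma subgraph_with_proj_iff:
  assumes "pair_wf_digraph F" "pair_wf_digraph G"
  shows "subgraph (with_proj F) (with_proj G) \<longleftrightarrow>
    pverts F \<subseteq> pverts G \<and> parcs F \<subseteq> parcs G"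
  using assms by (auto simp: subgraph_def compatible_def wf_digraph_wp_iff)

text \<open>This is \<open>C4_plus\<close> with 0, 1, 2, 3 renamed to \<open>p\<close>,
  \<open>q\<close>, \<open>r\<close>, \<open>s\<close>: the chord is \<open>pr\<close>. Several
  argument orders give the same graph, for instance \<open>p q r s\<close> and
  \<open>r q p s\<close>.\<close>

definition diamond :: "'a \<Rightarrow> 'a \<Rightarrow> 'a \<Rightarrow> 'a \<Rightarrow> 'a pair_pre_digraph" where
  "diamond p q r s = \<lparr>pverts = {p, q, r, s},
     parcs = {(p,q),(q,p),(q,r),(r,q),(r,s),(s,r),(s,p),(p,s),(p,r),(r,p)}\<rparr>"

lemma pair_graph_diamond:
  assumes "distinct [p, q, r, s]"
  shows "pair_graph (diamond p q r s)"
  using assms by unfold_locales (auto simp: diamond_def symmetric_def intro!: symI)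

lemma digraph_iso_C4_plus_iff:
  assumes "pair_graph F"
  shows "digraph_iso (with_proj F) (with_proj C4_plus) \<longleftrightarrow>
    (\<exists>p q r s. distinct [p, q, r, s] \<and> F = diamond p q r s)" (is "?L \<longleftrightarrow> ?R")
proof
  interpret C: pair_graph C4_plus by (rule pair_graph_C4_plus)
  interpret F: pair_graph F by fact
  assume ?L
  then have "digraph_iso (with_proj C4_plus) (with_proj F)"
    by (rule digraph_iso_swap[OF F.wf_digraph_axioms])
  then obtain f where f: "inj_on f (pverts C4_plus)" "pverts F = f ` pverts C4_plus"
    "parcs F = map_prod f f ` parcs C4_plus"
    by (auto simp: digraph_iso_with_proj_iff[OF C.pair_wf_digraph])
  have "distinct [f 0, f 1, f 2, f 3]"
    using f(1) by (auto simp: pverts_C4_plus inj_on_def)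
  moreover have "F = diamond (f 0) (f 1) (f 2) (f 3)"
    using f(2,3) by (intro pair_pre_digraph.equality)
      (simp_all add: diamond_def pverts_C4_plus parcs_C4_plus)
  ultimately show ?R by blast
next
  interpret C: pair_graph C4_plus by (rule pair_graph_C4_plus)
  assume ?R
  then obtain p q r s where d: "distinct [p, q, r, s]" and F: "F = diamond p q r s" by blast
  define f :: "nat \<Rightarrow> 'a" where
    "f i = (if i = 0 then p else if i = 1 then q else if i = 2 then r else s)" for i
  have "inj_on f (pverts C4_plus)" "pverts F = f ` pverts C4_plus"
    "parcs F = map_prod f f ` parcs C4_plus"
    using d unfolding F diamond_def pverts_C4_plus parcs_C4_plus
    by (simp_all add: f_def insert_commute)
  then have "digraph_iso (with_proj C4_plus) (with_proj F)"
    by (auto simp: digraph_iso_with_proj_iff[OF C.pair_wf_digraph])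
  then show ?L by (rule digraph_iso_swap[OF C.wf_digraph_axioms])
qed

text \<open>Inclusion of arcs is enough for a subgraph, because every vertex of a diamond is the end
  of an arc. Copies can then be exhibited by naming four vertices.\<close>

lemma copies_C4_plus:
  assumes "pair_graph G"
  shows "copies C4_plus G =
    {diamond p q r s |p q r s. distinct [p, q, r, s] \<and> parcs (diamond p q r s) \<subseteq> parcs G}"
proof -
  interpret pair_graph G by fact
  have sub: "subgraph (with_proj (diamond p q r s)) (with_proj G) \<longleftrightarrow>
      parcs (diamond p q r s) \<subseteq> parcs G" if "distinct [p, q, r, s]" for p q r s
  proof -
    interpret D: pair_graph "diamond p q r s" using that by (rule pair_graph_diamond)
    show ?thesis
      by (subst subgraph_with_proj_iff[OF D.pair_wf_digraph pair_wf_digraph])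
        (auto simp: diamond_def dest: in_arcsD1 in_arcsD2)
  qed
  show ?thesis
  proof (intro set_eqI iffI)
    fix F assume F: "F \<in> copies C4_plus G"
    then obtain p q r s where "distinct [p, q, r, s]" "F = diamond p q r s"
      unfolding copies_def by (auto simp only: digraph_iso_C4_plus_iff)
    with F sub show "F \<in> {diamond p q r s |p q r s.
        distinct [p, q, r, s] \<and> parcs (diamond p q r s) \<subseteq> parcs G}"
      unfolding copies_def by blast
  next
    fix F assume "F \<in> {diamond p q r s |p q r s.
        distinct [p, q, r, s] \<and> parcs (diamond p q r s) \<subseteq> parcs G}"
    then obtain p q r s where d: "distinct [p, q, r, s]" and F: "F = diamond p q r s"
      and "parcs (diamond p q r s) \<subseteq> parcs G" by blast
    then have "subgraph (with_proj F) (with_proj G)" using sub by blast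
    moreover have "pair_graph F" unfolding F using d by (rule pair_graph_diamond)
    moreover from this have "digraph_iso (with_proj F) (with_proj C4_plus)"
      using d F by (auto simp only: digraph_iso_C4_plus_iff)
    ultimately show "F \<in> copies C4_plus G" by (simp add: copies_def)
  qed
qed

section \<open>Vertices at distance 2\<close>

context pair_graph
begin

text \<open>The walk through \<open>y\<close> bounds the distance by 2. A walk of length 0 would put
  \<open>v\<close> in \<open>S\<close>, and one of length 1 would give it a neighbour there.\<close>

lemma mem_N2:
  assumes "(v, y) \<in> parcs G" "(y, s) \<in> parcs G" "s \<in> S" "v \<notin> S"
    and "\<And>s. s \<in> S \<Longrightarrow> (v, s) \<notin> parcs G"
  shows "v \<in> N2 G S"
proof -
  have walk: "awalk v [(v, y), (y, s)] s"
    using assms(1,2) in_arcsD2[OF assms(2)] by (simp add: awalk_Cons_iff awalk_Nil_iff)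
  have "gdist G v s \<le> 2"
    unfolding gdist_def using min_cost_le_walk_cost[OF walk, of "\<lambda>_. 1"] by simp
  then have le: "gdist_set G v S \<le> 2"
    unfolding gdist_set_def using \<open>s \<in> S\<close> by (auto intro: INF_lower2)
  have "2 \<le> awalk_cost (\<lambda>_. 1) p" if "t \<in> S" "awalk v p t" for t p
  proof -
    have "2 \<le> length p"
    proof (rule ccontr)
      assume "\<not> 2 \<le> length p"
      then consider "p = []" | e where "p = [e]"
        by (cases p; cases "tl p") auto
      then show False
        using that assms(4,5) by cases (auto simp: awalk_Cons_iff awalk_Nil_iff)
    qed
    then show ?thesis by (simp add: awalk_cost_def sum_list_triv)
  qed
  then have "2 \<le> gdist_set G v S"
    unfolding gdist_set_def gdist_def \<mu>_def
    by (intro INF_greatest) auto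
  with le show ?thesis
    using assms(1) by (auto simp: N2_def dest: in_arcsD1)
qed

section \<open>Local consequences of unique saturation\<close>

context
  assumes sat: "uniquely_saturated C4_plus G"
begin

lemma diamond_free:
  assumes "distinct [p, q, r, s]"
  shows "\<not> parcs (diamond p q r s) \<subseteq> parcs G"
  using sat assms unfolding uniquely_saturated_def copies_C4_plus[OF pair_graph] by blast

text \<open>Two triangles on the same edge \<open>pr\<close> form a diamond with chord
  \<open>pr\<close>.\<close>

lemma common_neighbour_unique:
  assumes "(p, r) \<in> parcs G" "(q, p) \<in> parcs G" "(q, r) \<in> parcs G"
    "(s, p) \<in> parcs G" "(s, r) \<in> parcs G"
  shows "q = s"
proof (rule ccontr)
  assume "q \<noteq> s"
  then have "distinct [p, q, r, s]" using assms by (auto dest: no_loops')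
  from diamond_free[OF this] show False
    using assms assms[THEN arcs_symmetric] by (simp add: diamond_def)
qed

text \<open>Vertex sets suffice to refute uniqueness: the competing diamonds constructed later
  differ in a vertex.\<close>

lemma added_diamond_unique:
  assumes "u \<in> pverts G" "v \<in> pverts G" "u \<noteq> v" "(u, v) \<notin> parcs G"
    and "distinct [p, q, r, s]" "parcs (diamond p q r s) \<subseteq> parcs (add_edge u v G)"
    and "distinct [p', q', r', s']" "parcs (diamond p' q' r' s') \<subseteq> parcs (add_edge u v G)"
  shows "{p, q, r, s} = {p', q', r', s'}"
proof -
  have "\<exists>!F. F \<in> copies C4_plus (add_edge u v G)"
    using sat assms(1-4) by (auto simp: uniquely_saturated_def)
  moreover have "diamond p q r s \<in> copies C4_plus (add_edge u v G)"
    "diamond p' q' r' s' \<in> copies C4_plus (add_edge u v G)"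
    using assms(5-8) unfolding copies_C4_plus[OF pair_graph_add_edge[OF pair_graph assms(1-3)]]
    by blast+
  ultimately have "pverts (diamond p q r s) = pverts (diamond p' q' r' s')" by metis
  then show ?thesis unfolding diamond_def pair_pre_digraph.simps .
qed

text \<open>The new diamond must use \<open>uv\<close>. Each edge of a diamond lies in a triangle,
  whose third vertex is \<open>w\<close>, and has an end of degree 3, which supplies the further
  neighbour \<open>z\<close>. The disjunction on \<open>z\<close> allows either end to play this
  role.\<close>

lemma nonadjacent_common_neighbour:
  assumes "u \<in> pverts G" "v \<in> pverts G" "u \<noteq> v" "(u, v) \<notin> parcs G"
  obtains w z where "(u, w) \<in> parcs G" "(v, w) \<in> parcs G" "z \<noteq> w"
    "(u, z) \<in> parcs G \<or> (v, z) \<in> parcs G"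
proof -
  have "\<exists>!F. F \<in> copies C4_plus (add_edge u v G)"
    using sat assms(1-4) by (auto simp: uniquely_saturated_def)
  then obtain F where "F \<in> copies C4_plus (add_edge u v G)" by (rule ex1E)
  then obtain p q r s where d: "distinct [p, q, r, s]"
    and sub: "parcs (diamond p q r s) \<subseteq> parcs (add_edge u v G)"
    unfolding copies_C4_plus[OF pair_graph_add_edge[OF pair_graph assms(1-3)]] by blast
  have arc: "(g, h) \<in> parcs G"
    if "(g, h) \<in> parcs (diamond p q r s)" "{g, h} \<noteq> {u, v}" for g h
    using sub that by (auto simp: add_edge_def)
  have ne: "p \<noteq> q" "p \<noteq> r" "p \<noteq> s" "q \<noteq> r" "q \<noteq> s" "r \<noteq> s" using d by auto
  obtain g h where gh: "(g, h) \<in> parcs (diamond p q r s)" "{g, h} = {u, v}"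
  proof (rule ccontr)
    assume "\<not> thesis"
    then have "parcs (diamond p q r s) \<subseteq> parcs G" using arc that by (metis subrelI)
    then show False using diamond_free[OF d] by blast
  qed
  have "{u, v} = {p, q} \<or> {u, v} = {q, r} \<or> {u, v} = {r, s} \<or> {u, v} = {s, p} \<or> {u, v} = {p, r}"
    using gh(1) unfolding gh(2)[symmetric] diamond_def
    by (simp, elim disjE) (simp_all add: doubleton_eq_iff)
  then consider "{u, v} = {p, q}" | "{u, v} = {q, r}" | "{u, v} = {r, s}" | "{u, v} = {s, p}"
    | "{u, v} = {p, r}" by (elim disjE)
  then show ?thesis
  proof cases
    case 1
    have "(p, r) \<in> parcs G" "(q, r) \<in> parcs G" "(p, s) \<in> parcs G" "s \<noteq> r"
      using ne ne[symmetric] by (simp_all add: arc diamond_def 1 doubleton_eq_iff)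
    then show ?thesis using 1 that[of r s] unfolding doubleton_eq_iff by blast
  next
    case 2
    have "(r, p) \<in> parcs G" "(q, p) \<in> parcs G" "(r, s) \<in> parcs G" "s \<noteq> p"
      using ne ne[symmetric] by (simp_all add: arc diamond_def 2 doubleton_eq_iff)
    then show ?thesis using 2 that[of p s] unfolding doubleton_eq_iff by blast
  next
    case 3
    have "(r, p) \<in> parcs G" "(s, p) \<in> parcs G" "(r, q) \<in> parcs G" "q \<noteq> p"
      using ne ne[symmetric] by (simp_all add: arc diamond_def 3 doubleton_eq_iff)
    then show ?thesis using 3 that[of p q] unfolding doubleton_eq_iff by blast
  next
    case 4
    have "(p, r) \<in> parcs G" "(s, r) \<in> parcs G" "(p, q) \<in> parcs G" "q \<noteq> r"
      using ne ne[symmetric] by (simp_all add: arc diamond_def 4 doubleton_eq_iff)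
    then show ?thesis using 4 that[of r q] unfolding doubleton_eq_iff by blast
  next
    case 5
    have "(p, q) \<in> parcs G" "(r, q) \<in> parcs G" "(p, s) \<in> parcs G" "s \<noteq> q"
      using ne ne[symmetric] by (simp_all add: arc diamond_def 5 doubleton_eq_iff)
    then show ?thesis using 5 that[of q s] unfolding doubleton_eq_iff by blast
  qed
qed

lemma triangle_neighbour_pendant:
  assumes abc: "(a, b) \<in> parcs G" "(b, c) \<in> parcs G" "(a, c) \<in> parcs G"
    and x: "x \<notin> {a, b, c}" "(x, a) \<in> parcs G"
    and y: "(x, y) \<in> parcs G" "s \<in> {a, b, c}" "(y, s) \<in> parcs G"
  shows "y = a"
proof (rule ccontr)
  assume "y \<noteq> a"
  \<comment> \<open>Here \<open>b\<close> and \<open>c\<close> are generalised, so that their roles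
    can be exchanged at the end.\<close>
  have *: False
    if t: "(a, b) \<in> parcs G" "(b, c) \<in> parcs G" "(a, c) \<in> parcs G" "x \<notin> {a, b, c}"
      and ys: "(y, a) \<in> parcs G \<or> (y, b) \<in> parcs G" for b c
  proof -
    note arcs = t(1-3) x(2) y(1) t(1-3)[THEN arcs_symmetric] x(2)[THEN arcs_symmetric]
      y(1)[THEN arcs_symmetric]
    have ne: "a \<noteq> b" "b \<noteq> c" "a \<noteq> c" "x \<noteq> y" using t y by (auto dest: no_loops')
    \<comment> \<open>Otherwise \<open>x\<close> and the third vertex of the triangle would be two
      common neighbours of the ends of \<open>ab\<close> or \<open>ac\<close>.\<close>
    have nadj: "(x, b) \<notin> parcs G" "(x, c) \<notin> parcs G"
      using common_neighbour_unique[of a b x c] common_neighbour_unique[of a c x b] arcs t(4)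
      by auto
    have y_notin: "y \<notin> {a, b, c}" using \<open>y \<noteq> a\<close> y(1) nadj by auto
    have verts: "x \<in> pverts G" "b \<in> pverts G" "x \<noteq> b"
      using x t by (auto dest: in_arcsD1 in_arcsD2)
    note uniq = added_diamond_unique[OF verts nadj(1), of a x b c]
    \<comment> \<open>The new edge \<open>xb\<close> lies on the 4-cycle, and the chord is
      \<open>ab\<close>.\<close>
    have first: "distinct [a, x, b, c]" "parcs (diamond a x b c) \<subseteq> parcs (add_edge x b G)"
      using arcs t(4) ne by (auto simp: diamond_def add_edge_def)
    from ys show False
    proof
      assume "(y, a) \<in> parcs G"
      note this this[THEN arcs_symmetric]
      \<comment> \<open>Now \<open>xa\<close> is the chord; this diamond contains \<open>y\<close>
        instead of \<open>c\<close>.\<close>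
      then have "distinct [x, y, a, b]" "parcs (diamond x y a b) \<subseteq> parcs (add_edge x b G)"
        using arcs t(4) ne y_notin by (auto simp: diamond_def add_edge_def)
      from uniq[OF first this] show False using y_notin ne t by auto
    next
      assume "(y, b) \<in> parcs G"
      note this this[THEN arcs_symmetric]
      \<comment> \<open>Now the new edge \<open>xb\<close> itself is the chord.\<close>
      then have "distinct [x, a, b, y]" "parcs (diamond x a b y) \<subseteq> parcs (add_edge x b G)"
        using arcs t(4) ne y_notin by (auto simp: diamond_def add_edge_def)
      from uniq[OF first this] show False using y_notin ne t by auto
    qed
  qed
  show False
    using *[of b c] *[of c b] abc abc(2)[THEN arcs_symmetric] x(1) y(2,3) by blast
qed

end

end

theorem theorem3p2:
  fixes G :: "'a pair_pre_digraph" and S :: "'a set"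
  assumes "pair_graph G"
    and "nontrivial_uniquely_saturated C4_plus G"
    and "girth G = 3"
    and "triangle_verts G S"
    and "N2 G S = {}"
  shows "digraph_iso (with_proj G) (with_proj C3_star)"
proof -
  interpret pair_graph G by fact
  note sym = arcs_symmetric
  have sat: "uniquely_saturated C4_plus G" and card: "4 \<le> card (pverts G)"
    using assms(2) by (auto simp: nontrivial_uniquely_saturated_def pverts_C4_plus)
  obtain T where T: "subgraph (with_proj T) (with_proj G)" "complete_digraph 3 (with_proj T)"
    "pverts T = S" using assms(4) by (auto simp: triangle_verts_def)
  have cardS: "card S = 3" and SV: "S \<subseteq> pverts G"
    and adjS: "\<And>u v. u \<in> S \<Longrightarrow> v \<in> S \<Longrightarrow> u \<noteq> v \<Longrightarrow> (u, v) \<in> parcs G"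
    using T by (auto simp: complete_digraph_def subgraph_def)
  have nbr: "\<exists>s\<in>S. (x, s) \<in> parcs G" if x: "x \<in> pverts G" "x \<notin> S" for x
  proof (rule ccontr)
    assume no: "\<not> (\<exists>s\<in>S. (x, s) \<in> parcs G)"
    \<comment> \<open>Any vertex of \<open>S\<close> will do, since \<open>x\<close> is adjacent to
      none of them.\<close>
    obtain s where s: "s \<in> S" using cardS by fastforce
    then obtain w where "(x, w) \<in> parcs G" "(s, w) \<in> parcs G"
      using nonadjacent_common_neighbour[OF sat, of x s] x no SV by blast
    then have "x \<in> N2 G S" using mem_N2[of x w s S] s x no sym by blast
    then show False using assms(5) by simp
  qed
  have pendant: "y = a"
    if x: "x \<notin> S" "a \<in> S" "(x, a) \<in> parcs G" "(x, y) \<in> parcs G" for x a y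
  proof -
    have "card (S - {a}) = 2" using cardS \<open>a \<in> S\<close> by simp
    then obtain b c where bc: "S - {a} = {b, c}" "b \<noteq> c" by (auto simp: card_2_iff)
    then have S: "S = {a, b, c}" and ne: "a \<noteq> b" "a \<noteq> c" using \<open>a \<in> S\<close> by auto
    \<comment> \<open>Inside \<open>S\<close> another vertex of the triangle serves as neighbour;
      outside, \<open>nbr\<close> provides one.\<close>
    have "\<exists>s\<in>S. (y, s) \<in> parcs G"
    proof (cases "y \<in> S")
      case True
      then show ?thesis using adjS[of y a] adjS[of y b] S ne bc by (cases "y = a") auto
    next
      case False
      then show ?thesis using nbr x(4) by (auto dest: in_arcsD2)
    qed
    then show ?thesis
      using triangle_neighbour_pendant[OF sat, of a b c x y] adjS S ne bc(2) x by auto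
  qed
  have finS: "finite S" using SV pair_finite_verts by (rule finite_subset)
  \<comment> \<open>Nontriviality enters here: \<open>G\<close> has at least four vertices.\<close>
  have "\<not> pverts G \<subseteq> S" using card cardS card_mono[OF finS, of "pverts G"] by linarith
  then obtain x where x: "x \<in> pverts G" "x \<notin> S" by blast
  then obtain a where a: "a \<in> S" "(x, a) \<in> parcs G" using nbr by blast
  have only: "y = x" if y: "y \<in> pverts G" "y \<notin> S" for y
  proof (rule ccontr)
    assume "y \<noteq> x"
    obtain b where b: "b \<in> S" "(y, b) \<in> parcs G" using nbr y by blast
    \<comment> \<open>An edge \<open>xy\<close> would force \<open>y = a\<close>, which lies in
      \<open>S\<close>.\<close>
    have "(x, y) \<notin> parcs G" using pendant[of x a y] x a y by auto
    \<comment> \<open>The only neighbours of \<open>x\<close> and \<open>y\<close> are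
      \<open>a\<close> and \<open>b\<close>. A common neighbour \<open>w\<close> equals both, which
      leaves no vertex \<open>z\<close> different from \<open>w\<close>.\<close>
    then show False
      using nonadjacent_common_neighbour[OF sat x(1) y(1)] pendant[OF x(2) a]
        pendant[OF y(2) b] \<open>y \<noteq> x\<close> by metis
  qed
  have "card (S - {a}) = 2" using cardS a by simp
  then obtain b c where bc: "S - {a} = {b, c}" "b \<noteq> c" by (auto simp: card_2_iff)
  then have S: "S = {a, b, c}" and ne: "a \<noteq> b" "a \<noteq> c" "b \<noteq> c" using a by auto
  have "pverts G = insert x S" using only x SV by blast
  then have verts: "pverts G = {a, b, c, x}" unfolding S by (simp add: insert_commute)
  have arcs: "parcs G = {(a,b),(b,a),(b,c),(c,b),(c,a),(a,c),(a,x),(x,a)}" (is "_ = ?A")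
  proof
    show "?A \<subseteq> parcs G" using adjS S ne a(2) a(2)[THEN sym] by simp
    show "parcs G \<subseteq> ?A"
    proof (rule subrelI)
      fix u v assume uv: "(u, v) \<in> parcs G"
      have "u \<in> {a, b, c, x}" "v \<in> {a, b, c, x}" "u \<noteq> v"
        using uv verts by (auto dest: in_arcsD1 in_arcsD2 no_loops')
      \<comment> \<open>The only edge at \<open>x\<close> is \<open>xa\<close>; all other edges lie
        inside the triangle.\<close>
      moreover have "v = a" if "u = x" using pendant x a uv that by blast
      moreover have "u = a" if "v = x" using pendant x a uv that sym by blast
      ultimately show "(u, v) \<in> ?A" by auto
    qed
  qed
  \<comment> \<open>The neighbour \<open>a\<close> of \<open>x\<close> must go to 0, where the
    pendant edge of \<open>C3_star\<close> is attached, and \<open>x\<close> to 3; \<open>b\<close>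
    and \<open>c\<close> are interchangeable.\<close>
  define f :: "'a \<Rightarrow> nat" where
    "f v = (if v = a then 0 else if v = b then 1 else if v = c then 2 else 3)" for v
  have f: "f a = 0" "f b = 1" "f c = 2" "f x = 3"
    using ne \<open>x \<notin> S\<close> S by (auto simp: f_def)
  have "inj_on f (pverts G)" "pverts C3_star = f ` pverts G"
    "parcs C3_star = map_prod f f ` parcs G"
    unfolding verts arcs pverts_C3_star parcs_C3_star using f by (auto simp: inj_on_def)
  then show ?thesis by (auto simp: digraph_iso_with_proj_iff[OF pair_wf_digraph])
qed

end
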